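(* Let $n\ge 1$ and $k\ge 1$ be integers, let $A=(a_{pq})$ be a real $n\times n$ matrix, and let $j\in\{1,\dots,n\}$ be such that $a_{1j}<0$. Suppose $\lambda>0$ is a simple eigenvalue of $A$ and $A\mathbf u=\lambda\mathbf u$, $\mathbf v^TA=\lambda\mathbf v^T$ for some entrywise positive vectors $\mathbf u,\mathbf v\in\mathbb R^n$. Define the real $(k+n)\times(k+n)$ matrix $B=(b_{pq})$ by $$b_{pq}=\begin{cases} \lambda-a_{1j},&\text{if }p=q\in\{1,\dots,k\};\\ a_{1j},&\text{if }(p,q)\in\{(k,k+j),(k+1,1)\}\cup\{(1,2),(2,3),\dots,(k-1,k)\};\\ a_{p-k,q-k},&\text{if }p,q\in\{k+1,\dots,k+n\}\text{ and }(p,q)\neq(k+1,k+j);\\ 0,&\text{otherwise}. \end{cases}$$ Then $\lambda$ is a simple eigenvalue of $B$, and $B\mathbf w=\lambda\mathbf w$, $\mathbf z^TB=\lambda\mathbf z^T$, where $w_i=u_j$ and $z_i=v_1$ for $1\le i\le k$, and $w_i=u_{i-k}$, $z_i=v_{i-k}$ for $k+1\le i\le k+n$. Consequently, $B$ is algebraically positive.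
   Context: A real square matrix $M$ is algebraically positive if there is a real polynomial $f$ such that every entry of $f(M)$ is positive. A simple eigenvalue is one of algebraic multiplicity one. *)

theory Defs
  imports "Jordan_Normal_Form.Matrix" "Jordan_Normal_Form.Char_Poly"
begin

fun mat_poly_coeffs :: "real mat \<Rightarrow> real list \<Rightarrow> real mat" where
  "mat_poly_coeffs A [] = 0\<^sub>m (dim_row A) (dim_row A)"
| "mat_poly_coeffs A (c # cs) = c \<cdot>\<^sub>m 1\<^sub>m (dim_row A) + A * mat_poly_coeffs A cs"

definition mat_poly :: "real poly \<Rightarrow> real mat \<Rightarrow> real mat" where
  "mat_poly f A = mat_poly_coeffs A (coeffs f)"

definition alg_positive :: "real mat \<Rightarrow> bool" where
  "alg_positive M \<longleftrightarrow> (\<exists>f. \<forall>i < dim_row M. \<forall>j < dim_col M. mat_poly f M $$ (i, j) > 0)"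

definition simple_eigenvalue :: "real mat \<Rightarrow> real \<Rightarrow> bool" where
  "simple_eigenvalue A l \<longleftrightarrow> eigenvalue A l \<and> order l (char_poly A) = 1"

(* the matrix B of the paper, with 1-based indices p q; a p q = A(p,q) 1-based *)
definition B_entry :: "nat \<Rightarrow> nat \<Rightarrow> (nat \<Rightarrow> nat \<Rightarrow> real) \<Rightarrow> nat \<Rightarrow> real \<Rightarrow> nat \<Rightarrow> nat \<Rightarrow> real" where
  "B_entry k n a j l p q =
     (if p = q \<and> p \<in> {1..k} then l - a 1 j
      else if (p, q) \<in> {(k, k + j), (k + 1, 1)} \<union> {(i, i + 1) | i. 1 \<le> i \<and> i \<le> k - 1} then a 1 j
      else if p \<in> {k+1..k+n} \<and> q \<in> {k+1..k+n} \<and> (p, q) \<noteq> (k + 1, k + j) then a (p - k) (q - k)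
      else 0)"

definition B_mat :: "nat \<Rightarrow> real mat \<Rightarrow> nat \<Rightarrow> real \<Rightarrow> real mat" where
  "B_mat k A j l = (let n = dim_row A in
     mat (k + n) (k + n) (\<lambda>(p, q). B_entry k n (\<lambda>r s. A $$ (r - 1, s - 1)) j l (p + 1) (q + 1)))"

end

(* No determinant of B is computed.  The rows 1..k of B - l force a kernel vector to be constant on the
   first k entries and equal there to the entry k + j; row k + 1 then reads as the first row of A - l, so
   ker (B - l) is the extension of ker (A - l).  Since the left and right eigenvectors z and w are positive,
   their product is nonzero, which excludes generalised eigenvectors, and l is a simple root.
   For g = char_poly B / (X - l), Cayley-Hamilton shows that g(B) is a nonzero multiple of w z^T. *)
theory Submission
  imports Defs
begin

section \<open>Eigenvector equations in coordinates and the characteristic matrix\<close>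

lemma mat_vec_entry:
  assumes "M \<in> carrier_mat n n" and "x \<in> carrier_vec n" and "i < n"
  shows "(M *\<^sub>v x) $ i = (\<Sum>k<n. M $$ (i, k) * x $ k)"
  using assms by (auto simp: scalar_prod_def lessThan_atLeast0)

lemma eigen_eq_iff:
  assumes "M \<in> carrier_mat n n" and "x \<in> carrier_vec n"
  shows "M *\<^sub>v x = l \<cdot>\<^sub>v x \<longleftrightarrow> (\<forall>i<n. (\<Sum>k<n. M $$ (i, k) * x $ k) = l * x $ i)"
  using assms by (auto simp: vec_eq_iff scalar_prod_def lessThan_atLeast0)

lemma transpose_eigen_eq_iff:
  assumes "M \<in> carrier_mat n n" and "x \<in> carrier_vec n"
  shows "transpose_mat M *\<^sub>v x = l \<cdot>\<^sub>v x \<longleftrightarrow> (\<forall>i<n. (\<Sum>k<n. M $$ (k, i) * x $ k) = l * x $ i)"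
proof -
  have "transpose_mat M \<in> carrier_mat n n" using assms by simp
  from eigen_eq_iff[OF this assms(2)] show ?thesis using assms by auto
qed

lemma replace_col_closed:
  "M \<in> carrier_mat n n \<Longrightarrow> replace_col M b k \<in> carrier_mat n n"
  by (auto simp: replace_col_def)

text \<open>Cofactors along column \<open>k\<close> do not see that column, so \<open>c\<close>
  factors out of the Laplace expansion. This pulls X - l out of a replaced column.\<close>

lemma det_replace_col_smult:
  fixes c :: "'a :: comm_ring_1"
  assumes M: "M \<in> carrier_mat n n" and b: "b \<in> carrier_vec n" and k: "k < n"
  shows "det (replace_col M (c \<cdot>\<^sub>v b) k) = c * det (replace_col M b k)"
proof -
  have del: "mat_delete (replace_col M (c \<cdot>\<^sub>v b) k) i k = mat_delete (replace_col M b k) i k" for i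
    by (rule eq_matI) (auto simp: mat_delete_def replace_col_def)
  have entry: "replace_col M d k $$ (i, k) = d $ i" if "i < n" for d i
    using M k that by (simp add: replace_col_def)
  show ?thesis
    unfolding laplace_expansion_column[OF replace_col_closed[OF M] k] sum_distrib_left
    by (rule sum.cong) (use M b k in \<open>auto simp: del entry cofactor_def ac_simps\<close>)
qed

lemma char_poly_matrix_entry:
  assumes "M \<in> carrier_mat n n" and "i < n" and "j < n"
  shows "char_poly_matrix M $$ (i, j) = (if i = j then [:0, 1:] else 0) + [:- M $$ (i, j):]"
  using assms by (auto simp: char_poly_matrix_def)

text \<open>Moves the eigenvector equation to the polynomial ring, where Cramer's rule links X - l
  with the determinant of the characteristic matrix.\<close>

lemma char_poly_matrix_eigenvector:
  fixes M :: "'a :: comm_ring_1 mat"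
  assumes M: "M \<in> carrier_mat n n" and x: "x \<in> carrier_vec n" and ev: "M *\<^sub>v x = l \<cdot>\<^sub>v x"
  shows "char_poly_matrix M *\<^sub>v map_vec (\<lambda>a. [:a:]) x = [:- l, 1:] \<cdot>\<^sub>v map_vec (\<lambda>a. [:a:]) x"
proof (rule eq_vecI)
  fix i assume "i < dim_vec ([:- l, 1:] \<cdot>\<^sub>v map_vec (\<lambda>a. [:a:]) x)"
  hence i: "i < n" using x by simp
  have "(char_poly_matrix M *\<^sub>v map_vec (\<lambda>a. [:a:]) x) $ i
      = (\<Sum>k<n. ((if i = k then [:0, 1:] else 0) + [:- M $$ (i, k):]) * [:x $ k:])"
    using M x i by (subst mat_vec_entry[of _ n]) (auto simp: char_poly_matrix_entry)
  also have "\<dots> = (\<Sum>k<n. if i = k then [:0, 1:] * [:x $ k:] else 0) + (\<Sum>k<n. [:- (M $$ (i, k) * x $ k):])"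
    unfolding sum.distrib[symmetric] by (rule sum.cong) auto
  also have "(\<Sum>k<n. [:- (M $$ (i, k) * x $ k):]) = [:- (\<Sum>k<n. M $$ (i, k) * x $ k):]"
    by (simp add: poly_eq_iff coeff_sum coeff_pCons sum_negf split: nat.splits)
  also have "(\<Sum>k<n. M $$ (i, k) * x $ k) = l * x $ i"
    using ev eigen_eq_iff[OF M x] i by blast
  finally show "(char_poly_matrix M *\<^sub>v map_vec (\<lambda>a. [:a:]) x) $ i = ([:- l, 1:] \<cdot>\<^sub>v map_vec (\<lambda>a. [:a:]) x) $ i"
    using i x by simp
qed (use char_poly_matrix_closed[OF M] x in auto)

section \<open>Simple roots and one-dimensional eigenspaces\<close>

text \<open>Cramer's rule extracts one factor \<open>X - l\<close> from the characteristic polynomial for each of two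
  independent eigenvectors.\<close>

lemma simple_root_eigenspace:
  fixes M :: "real mat"
  assumes M: "M \<in> carrier_mat n n" and order: "order l (char_poly M) = 1"
    and u: "u \<in> carrier_vec n" and evu: "M *\<^sub>v u = l \<cdot>\<^sub>v u" and i: "i < n" and ui: "u $ i \<noteq> 0"
    and x: "x \<in> carrier_vec n" and evx: "M *\<^sub>v x = l \<cdot>\<^sub>v x"
  shows "x = (x $ i / u $ i) \<cdot>\<^sub>v u"
proof (rule ccontr)
  assume neq: "x \<noteq> (x $ i / u $ i) \<cdot>\<^sub>v u"
  \<comment> \<open>The multiple of \<open>u\<close> is chosen so that \<open>y\<close> vanishes at
    index \<open>i\<close>; products with \<open>y\<close> then ignore column
    \<open>i\<close>.\<close>
  define y where "y = x - (x $ i / u $ i) \<cdot>\<^sub>v u"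
  have y: "y \<in> carrier_vec n" using x u by (simp add: y_def)
  have yi: "y $ i = 0" using x u i ui by (simp add: y_def)
  obtain m where m: "m < n" "y $ m \<noteq> 0"
    using neq x u by (auto simp: y_def vec_eq_iff)
  have "M *\<^sub>v y = l \<cdot>\<^sub>v y"
    using evu evx unfolding eigen_eq_iff[OF M u] eigen_eq_iff[OF M x] eigen_eq_iff[OF M y]
    using x u by (simp add: y_def right_diff_distrib sum_subtractf mult.left_commute[of _ "x $ i / u $ i"]
        del: times_divide_eq_left flip: sum_distrib_left)
  define h :: "real vec \<Rightarrow> real poly vec" where "h = map_vec (\<lambda>a. [:a:])"
  have h: "h z \<in> carrier_vec n" if "z \<in> carrier_vec n" for z using that by (simp add: h_def)
  define P where "P = char_poly_matrix M"
  have P: "P \<in> carrier_mat n n" using M by (simp add: P_def)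
  have Pu: "P *\<^sub>v h u = [:- l, 1:] \<cdot>\<^sub>v h u" and Py: "P *\<^sub>v h y = [:- l, 1:] \<cdot>\<^sub>v h y"
    unfolding P_def h_def by (rule char_poly_matrix_eigenvector; fact)+
  define Q where "Q = replace_col P (h u) i"
  have Q: "Q \<in> carrier_mat n n" unfolding Q_def by (rule replace_col_closed[OF P])
  \<comment> \<open>Cramer's rule for \<open>P\<close> and \<open>h u\<close>: the column put in
    place of column \<open>i\<close> is X - l times \<open>h u\<close>, whence the factor on the
    left.\<close>
  have detQ: "[:- l, 1:] * det Q = [:u $ i:] * char_poly M"
    using cramer_lemma_mat[OF P h[OF u] i, unfolded Pu det_replace_col_smult[OF P h[OF u] i]] i u
    by (simp add: Q_def char_poly_def P_def h_def)
  \<comment> \<open>\<open>P\<close> and \<open>Q\<close> differ only in column \<open>i\<close>,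
    where \<open>y\<close> is zero. So Cramer's rule applies once more, now to \<open>Q\<close> and
    column \<open>m\<close>.\<close>
  have "Q *\<^sub>v h y = P *\<^sub>v h y"
  proof (rule eq_vecI)
    fix r assume "r < dim_vec (P *\<^sub>v h y)"
    hence r: "r < n" using P by simp
    show "(Q *\<^sub>v h y) $ r = (P *\<^sub>v h y) $ r"
      unfolding mat_vec_entry[OF Q h[OF y] r] mat_vec_entry[OF P h[OF y] r]
      by (rule sum.cong) (use P r i y yi in \<open>auto simp: Q_def replace_col_def h_def\<close>)
  qed (use P Q in auto)
  hence detR: "[:- l, 1:] * det (replace_col Q (h y) m) = [:y $ m:] * det Q"
    using cramer_lemma_mat[OF Q h[OF y] m(1)] m y
    by (simp only: Py det_replace_col_smult[OF Q h[OF y] m(1)]) (simp add: h_def)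
  have "[:- l, 1:] ^ 2 * det (replace_col Q (h y) m) = [:- l, 1:] * ([:- l, 1:] * det (replace_col Q (h y) m))"
    by (simp only: power2_eq_square ac_simps)
  also have "\<dots> = [:y $ m:] * ([:- l, 1:] * det Q)"
    unfolding detR by (simp only: ac_simps)
  also have "\<dots> = Polynomial.smult (y $ m * u $ i) (char_poly M)"
    unfolding detQ by (simp add: mult.commute)
  finally have "[:- l, 1:] ^ 2 dvd Polynomial.smult (y $ m * u $ i) (char_poly M)"
    by (metis dvd_triv_left)
  hence "[:- l, 1:] ^ 2 dvd char_poly M"
    by (rule dvd_smult_cancel) (use m ui in simp)
  moreover have "char_poly M \<noteq> 0" using degree_monic_char_poly[OF M] by auto
  ultimately show False using order by (simp only: order_divides) auto
qed

text \<open>Cramer's rule gives (X - l) \<open>det Q\<close> as a nonzero multiple of the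
  characteristic polynomial, so it suffices that \<open>det Q\<close> does not vanish at
  \<open>l\<close>. Otherwise a kernel vector would yield a generalised eigenvector above
  \<open>w\<close>, which pairing with \<open>z\<close> excludes, or a second independent
  eigenvector, which \<open>one\<close> excludes.\<close>

lemma eigenspace_simple_root:
  fixes M :: "real mat"
  assumes M: "M \<in> carrier_mat n n" and w: "w \<in> carrier_vec n" and evw: "M *\<^sub>v w = l \<cdot>\<^sub>v w"
    and z: "z \<in> carrier_vec n" and evz: "transpose_mat M *\<^sub>v z = l \<cdot>\<^sub>v z"
    and zw: "(\<Sum>r<n. z $ r * w $ r) \<noteq> 0" and i: "i < n" and wi: "w $ i \<noteq> 0"
    and one: "\<And>y. y \<in> carrier_vec n \<Longrightarrow> M *\<^sub>v y = l \<cdot>\<^sub>v y \<Longrightarrow> \<exists>c. y = c \<cdot>\<^sub>v w"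
  shows "order l (char_poly M) = 1"
proof -
  define h :: "real vec \<Rightarrow> real poly vec" where "h = map_vec (\<lambda>a. [:a:])"
  have hw: "h w \<in> carrier_vec n" using w by (simp add: h_def)
  define P where "P = char_poly_matrix M"
  have P: "P \<in> carrier_mat n n" using M by (simp add: P_def)
  have Pw: "P *\<^sub>v h w = [:- l, 1:] \<cdot>\<^sub>v h w"
    unfolding P_def h_def by (rule char_poly_matrix_eigenvector; fact)
  define Q where "Q = replace_col P (h w) i"
  have Q: "Q \<in> carrier_mat n n" unfolding Q_def by (rule replace_col_closed[OF P])
  have detQ: "[:- l, 1:] * det Q = [:w $ i:] * char_poly M"
    using cramer_lemma_mat[OF P hw i, unfolded Pw det_replace_col_smult[OF P hw i]] i w
    by (simp add: Q_def char_poly_def P_def h_def)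
  \<comment> \<open>\<open>R\<close> is \<open>Q\<close> at X = l, so its determinant is the value
    of \<open>det Q\<close> at \<open>l\<close>.\<close>
  define R where "R = map_mat (\<lambda>p. poly p l) Q"
  have R: "R \<in> carrier_mat n n" using Q by (simp add: R_def)
  have Rent: "R $$ (r, s) = (if s = i then w $ r else (if r = s then l else 0) - M $$ (r, s))"
    if "r < n" "s < n" for r s
    using that P Q w char_poly_matrix_entry[OF M that, folded P_def]
    by (auto simp: R_def) (auto simp: Q_def replace_col_def h_def)
  have "det R \<noteq> 0"
  proof
    assume "det R = 0"
    then obtain y where y: "y \<in> carrier_vec n" "y \<noteq> 0\<^sub>v n" "R *\<^sub>v y = 0\<^sub>v n"
      using det_0_iff_vec_prod_zero_field[OF R] by auto
    \<comment> \<open>Column \<open>i\<close> of \<open>R\<close> is \<open>w\<close> and the others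
      come from l - M. Separating coordinate \<open>i\<close> turns R y = 0 into M y' = l y' + y_i
      w.\<close>
    define y' where "y' = vec n (\<lambda>s. if s = i then 0 else y $ s)"
    have y': "y' \<in> carrier_vec n" by (simp add: y'_def)
    have eq: "y $ i * w $ r + l * y' $ r = (\<Sum>s<n. M $$ (r, s) * y' $ s)" if r: "r < n" for r
    proof -
      have "0 = (\<Sum>s<n. R $$ (r, s) * y $ s)"
        using y r mat_vec_entry[OF R y(1) r] by simp
      also have "\<dots> = (\<Sum>s<n. (if s = i then y $ s * w $ r else 0) + (if s = r then l * y' $ s else 0) - M $$ (r, s) * y' $ s)"
        by (rule sum.cong) (use r in \<open>auto simp: Rent y'_def algebra_simps\<close>)
      also have "\<dots> = y $ i * w $ r + l * y' $ r - (\<Sum>s<n. M $$ (r, s) * y' $ s)"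
        using i r by (simp add: sum_subtractf sum.distrib)
      finally show ?thesis by simp
    qed
    \<comment> \<open>Pair with the left eigenvector \<open>z\<close>: the terms l (z . y') on both
      sides cancel, leaving y_i (z . w) = 0.\<close>
    have "(\<Sum>r<n. z $ r * (y $ i * w $ r + l * y' $ r)) = (\<Sum>r<n. \<Sum>s<n. z $ r * (M $$ (r, s) * y' $ s))"
      by (simp add: eq sum_distrib_left)
    also have "\<dots> = (\<Sum>s<n. \<Sum>r<n. z $ r * (M $$ (r, s) * y' $ s))" by (rule sum.swap)
    also have "\<dots> = (\<Sum>s<n. (\<Sum>r<n. M $$ (r, s) * z $ r) * y' $ s)"
      by (simp add: sum_distrib_left sum_distrib_right ac_simps)
    also have "\<dots> = (\<Sum>s<n. l * z $ s * y' $ s)"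
      using evz unfolding transpose_eigen_eq_iff[OF M z] by simp
    finally have "y $ i * (\<Sum>r<n. z $ r * w $ r) = 0"
      by (simp add: distrib_left sum.distrib sum_distrib_left ac_simps)
    hence yi: "y $ i = 0" using zw by simp
    hence yy: "y' = y" using y by (auto simp: y'_def vec_eq_iff)
    have "M *\<^sub>v y = l \<cdot>\<^sub>v y" unfolding eigen_eq_iff[OF M y(1)] using eq yi yy by auto
    then obtain c where c: "y = c \<cdot>\<^sub>v w" using one y by blast
    hence "c = 0" using yi i w wi by simp
    thus False using c y w by auto
  qed
  hence "poly (det Q) l \<noteq> 0"
    using poly_det_cong[OF R Q, of l] Q by (simp add: R_def)
  hence ord: "order l (det Q) = 0" and dQ: "det Q \<noteq> 0" by (auto simp: order_root)
  have "order l ([:- l, 1:] * det Q) = order l [:- l, 1:] + order l (det Q)"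
    by (rule order_mult) (use dQ in \<open>simp del: mult_pCons_left\<close>)
  also have "order l [:- l, 1:] = 1" using order_power_n_n[of l 1] by simp
  finally show ?thesis using ord wi unfolding detQ by (simp add: order_smult)
qed

section \<open>Polynomials evaluated at a matrix\<close>

lemma mat_poly_closed:
  assumes "M \<in> carrier_mat n n"
  shows "mat_poly p M \<in> carrier_mat n n"
proof -
  have "mat_poly_coeffs M cs \<in> carrier_mat n n" for cs
    using assms by (induction cs) auto
  thus ?thesis by (simp add: mat_poly_def)
qed

lemma mat_poly_0:
  "M \<in> carrier_mat n n \<Longrightarrow> mat_poly 0 M = 0\<^sub>m n n"
  by (simp add: mat_poly_def)

lemma mat_poly_pCons:
  assumes "M \<in> carrier_mat n n"
  shows "mat_poly (pCons a p) M = a \<cdot>\<^sub>m 1\<^sub>m n + M * mat_poly p M"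
  \<comment> \<open>\<open>coeffs\<close> of \<open>pCons 0 0\<close> is the empty list, so there
    the recursion does not unfold and both sides are zero.\<close>
  using assms by (cases "a = 0 \<and> p = 0") (auto simp: mat_poly_def cCons_def)

lemma mat_poly_pCons_entry:
  assumes M: "M \<in> carrier_mat n n" and "i < n" and "j < n"
  shows "mat_poly (pCons a p) M $$ (i, j)
    = (if i = j then a else 0) + (\<Sum>k<n. M $$ (i, k) * mat_poly p M $$ (k, j))"
  using assms mat_poly_closed[OF M, of p]
  by (simp add: mat_poly_pCons[OF M] scalar_prod_def lessThan_atLeast0)

lemma mat_poly_add_entry:
  assumes M: "M \<in> carrier_mat n n" and "i < n" and "j < n"
  shows "mat_poly (p + q) M $$ (i, j) = mat_poly p M $$ (i, j) + mat_poly q M $$ (i, j)"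
  using assms(2)
\<comment> \<open>Left multiplication by \<open>M\<close> mixes rows, so the row index is
  generalised while the column stays fixed.\<close>
proof (induction p q arbitrary: i rule: poly_induct2)
  case 0
  thus ?case using assms by (simp add: mat_poly_0[OF M])
next
  case (pCons a p b q)
  thus ?case using assms
    by (simp add: mat_poly_pCons_entry[OF M] distrib_left sum.distrib)
qed

lemma mat_poly_smult_entry:
  assumes M: "M \<in> carrier_mat n n" and "i < n" and "j < n"
  shows "mat_poly (Polynomial.smult c p) M $$ (i, j) = c * mat_poly p M $$ (i, j)"
  using assms(2)
proof (induction p arbitrary: i)
  case 0
  thus ?case using assms by (simp add: mat_poly_0[OF M])
next
  case (pCons a p)
  thus ?case using assms
    by (simp add: mat_poly_pCons_entry[OF M] distrib_left sum_distrib_left mult.left_commute)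
qed

text \<open>Serves to turn M g(M) = l g(M), a statement on the columns of g(M), into one on its
  rows.\<close>

lemma mat_poly_commute:
  assumes M: "M \<in> carrier_mat n n"
  shows "M * mat_poly p M = mat_poly p M * M"
proof (induction p)
  case 0
  thus ?case using M by (simp add: mat_poly_0[OF M])
next
  case (pCons a p)
  note G = mat_poly_closed[OF M, of p]
  have "M * (a \<cdot>\<^sub>m 1\<^sub>m n + M * mat_poly p M) = M * (a \<cdot>\<^sub>m 1\<^sub>m n) + M * (M * mat_poly p M)"
    using M G by (intro mult_add_distrib_mat[of _ n n _ n]) auto
  also have "\<dots> = a \<cdot>\<^sub>m 1\<^sub>m n * M + M * (mat_poly p M * M)"
    using M by (simp add: pCons.IH mult_smult_distrib[OF M one_carrier_mat] mult_smult_assoc_mat[of _ n n])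
  also have "M * (mat_poly p M * M) = M * mat_poly p M * M"
    using M G by simp
  also have "a \<cdot>\<^sub>m 1\<^sub>m n * M + M * mat_poly p M * M = (a \<cdot>\<^sub>m 1\<^sub>m n + M * mat_poly p M) * M"
    using M G by (intro add_mult_distrib_mat[symmetric]) auto
  finally show ?case by (simp add: mat_poly_pCons[OF M])
qed

lemma mat_poly_eigenvector:
  assumes M: "M \<in> carrier_mat n n" and w: "w \<in> carrier_vec n" and ev: "M *\<^sub>v w = l \<cdot>\<^sub>v w"
    and "i < n"
  shows "(\<Sum>j<n. mat_poly p M $$ (i, j) * w $ j) = poly p l * w $ i"
  using \<open>i < n\<close>
proof (induction p arbitrary: i)
  case 0
  thus ?case by (simp add: mat_poly_0[OF M])
next
  case (pCons a p)
  have "(\<Sum>j<n. mat_poly (pCons a p) M $$ (i, j) * w $ j)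
      = (\<Sum>j<n. if i = j then a * w $ j else 0)
        + (\<Sum>j<n. \<Sum>k<n. M $$ (i, k) * (mat_poly p M $$ (k, j) * w $ j))"
    unfolding sum.distrib[symmetric] using pCons.prems
    by (intro sum.cong) (auto simp: mat_poly_pCons_entry[OF M] distrib_right sum_distrib_right mult.assoc)
  also have "(\<Sum>j<n. \<Sum>k<n. M $$ (i, k) * (mat_poly p M $$ (k, j) * w $ j))
      = (\<Sum>k<n. \<Sum>j<n. M $$ (i, k) * (mat_poly p M $$ (k, j) * w $ j))"
    by (rule sum.swap)
  also have "\<dots> = (\<Sum>k<n. poly p l * (M $$ (i, k) * w $ k))"
    by (simp add: pCons.IH flip: sum_distrib_left) (simp add: sum_distrib_left mult.left_commute)
  also have "\<dots> = poly p l * (l * w $ i)"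
    using ev pCons.prems unfolding eigen_eq_iff[OF M w] by (simp flip: sum_distrib_left)
  finally show ?case using pCons.prems by (simp add: algebra_simps)
qed

section \<open>The Cayley-Hamilton theorem\<close>

text \<open>Horner's scheme for \<open>p(M)\<close> runs through the coefficient matrices of a quotient of \<open>p \<cdot> 1\<close> by \<open>X - M\<close>.\<close>

lemma mat_poly_quotient:
  assumes M: "M \<in> carrier_mat n n" and C: "\<And>m. C m \<in> carrier_mat n n"
    and zero: "\<And>m. m \<ge> d \<Longrightarrow> C m = 0\<^sub>m n n"
    and step: "\<And>m. C m = coeff p (Suc m) \<cdot>\<^sub>m 1\<^sub>m n + M * C (Suc m)"
  shows "mat_poly p M = coeff p 0 \<cdot>\<^sub>m 1\<^sub>m n + M * C 0"
  using C zero step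
proof (induction p arbitrary: C)
  case 0
  \<comment> \<open>For p = 0 the recursion is C_m = M C_(m+1), so vanishing descends from
    \<open>d\<close> to every index.\<close>
  have "C m = 0\<^sub>m n n" for m
  proof (cases "m \<le> d")
    case True
    thus ?thesis
    proof (induction rule: inc_induct)
      case (step m)
      show ?case using M by (subst 0(3)) (auto simp: step.IH)
    qed (simp add: 0(2))
  qed (simp add: 0(2))
  thus ?case using M by (auto simp: mat_poly_0[OF M] intro!: eq_matI)
next
  case (pCons a p)
  \<comment> \<open>The induction hypothesis is applied to the family shifted by one; the recursion
    at index 0 identifies its value with \<open>C 0\<close>.\<close>
  have "mat_poly p M = coeff p 0 \<cdot>\<^sub>m 1\<^sub>m n + M * C (Suc 0)"
  proof (rule pCons.IH)
    show "C (Suc m) = coeff p (Suc m) \<cdot>\<^sub>m 1\<^sub>m n + M * C (Suc (Suc m))" for m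
      using pCons.prems(3)[of "Suc m"] by simp
  qed (use pCons.prems(1,2) in auto)
  also have "\<dots> = C 0" using pCons.prems(3)[of 0] by simp
  finally show ?case by (simp add: mat_poly_pCons[OF M])
qed

text \<open>The adjugate N of X - M satisfies (X - M) N = \<open>char_poly M\<close> times the
  identity. Its coefficient matrices are thus the quotient that \<open>mat_poly_quotient\<close>
  asks for, and the constant coefficient says that the remainder is zero.\<close>

theorem cayley_hamilton:
  assumes M: "M \<in> carrier_mat n n"
  shows "mat_poly (char_poly M) M = 0\<^sub>m n n"
proof -
  define P where "P = char_poly_matrix M"
  have P: "P \<in> carrier_mat n n" using M by (simp add: P_def)
  define N where "N = adj_mat P"
  note N = adj_mat(1)[OF P, folded N_def]
  define C where "C m = mat n n (\<lambda>(i, j). coeff (N $$ (i, j)) m)" for m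
  have C: "C m \<in> carrier_mat n n" for m by (simp add: C_def)
  have entry: "(if i = j then char_poly M else 0)
      = pCons 0 (N $$ (i, j)) - (\<Sum>k<n. Polynomial.smult (M $$ (i, k)) (N $$ (k, j)))" if ij: "i < n" "j < n" for i j
  proof -
    have "(if i = j then char_poly M else 0) = (P * N) $$ (i, j)"
      using ij adj_mat(2)[OF P, folded N_def] by (simp add: char_poly_def P_def)
    also have "\<dots> = (\<Sum>k<n. P $$ (i, k) * N $$ (k, j))"
      using ij P N by (simp add: scalar_prod_def lessThan_atLeast0)
    also have "\<dots> = (\<Sum>k<n. (if i = k then pCons 0 (N $$ (k, j)) else 0) - Polynomial.smult (M $$ (i, k)) (N $$ (k, j)))"
      by (rule sum.cong) (use M ij in \<open>auto simp: P_def char_poly_matrix_entry\<close>)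
    also have "\<dots> = pCons 0 (N $$ (i, j)) - (\<Sum>k<n. Polynomial.smult (M $$ (i, k)) (N $$ (k, j)))"
      using ij by (simp add: sum_subtractf)
    finally show ?thesis .
  qed
  \<comment> \<open>The coefficient of X^m: c_m times the identity is C_(m-1) - M C_m, where
    \<open>pCons 0\<close> makes C_(-1) zero. Index \<open>Suc m\<close> gives the recursion, index
    0 the vanishing of the result.\<close>
  have coeffs: "(if i = j then coeff (char_poly M) m else 0)
      = coeff (pCons 0 (N $$ (i, j))) m - (M * C m) $$ (i, j)" if ij: "i < n" "j < n" for i j m
    using arg_cong[OF entry[OF ij], of "\<lambda>p. coeff p m"] ij M C[of m]
    by (simp add: coeff_sum scalar_prod_def lessThan_atLeast0 C_def if_distrib[of "\<lambda>p. coeff p m"] cong: if_cong)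
  \<comment> \<open>A strict degree bound common to all entries makes \<open>C m\<close> zero from
    \<open>d\<close> on.\<close>
  obtain d where d: "\<And>i j. i < n \<Longrightarrow> j < n \<Longrightarrow> degree (N $$ (i, j)) < d"
  proof
    show "degree (N $$ (i, j)) < Suc (\<Sum>i<n. \<Sum>j<n. degree (N $$ (i, j)))" if "i < n" "j < n" for i j
    proof -
      have "degree (N $$ (i, j)) \<le> (\<Sum>j<n. degree (N $$ (i, j)))"
        using that by (intro member_le_sum) auto
      also have "\<dots> \<le> (\<Sum>i<n. \<Sum>j<n. degree (N $$ (i, j)))"
        using that by (intro member_le_sum[of i _ "\<lambda>i. \<Sum>j<n. degree (N $$ (i, j))"]) auto
      finally show ?thesis by simp
    qed
  qed
  have "mat_poly (char_poly M) M = coeff (char_poly M) 0 \<cdot>\<^sub>m 1\<^sub>m n + M * C 0"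
  proof (rule mat_poly_quotient[OF M C])
    show "C m = 0\<^sub>m n n" if "m \<ge> d" for m
      by (rule eq_matI) (use that d in \<open>auto simp: C_def intro!: coeff_eq_0 intro: less_le_trans\<close>)
    show "C m = coeff (char_poly M) (Suc m) \<cdot>\<^sub>m 1\<^sub>m n + M * C (Suc m)" for m
    proof (rule eq_matI)
      fix i j assume "i < dim_row (coeff (char_poly M) (Suc m) \<cdot>\<^sub>m 1\<^sub>m n + M * C (Suc m))"
        "j < dim_col (coeff (char_poly M) (Suc m) \<cdot>\<^sub>m 1\<^sub>m n + M * C (Suc m))"
      hence ij: "i < n" "j < n" using M C[of "Suc m"] by auto
      thus "C m $$ (i, j) = (coeff (char_poly M) (Suc m) \<cdot>\<^sub>m 1\<^sub>m n + M * C (Suc m)) $$ (i, j)"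
        using coeffs[OF ij, of "Suc m"] M C[of "Suc m"]
        by (auto simp: C_def[of m] simp del: index_mult_mat(1) split: if_splits)
    qed (use M C[of m] C[of "Suc m"] in auto)
  qed
  also have "\<dots> = 0\<^sub>m n n"
  proof (rule eq_matI)
    fix i j assume "i < dim_row (0\<^sub>m n n :: real mat)" "j < dim_col (0\<^sub>m n n :: real mat)"
    hence ij: "i < n" "j < n" by auto
    thus "(coeff (char_poly M) 0 \<cdot>\<^sub>m 1\<^sub>m n + M * C 0) $$ (i, j) = 0\<^sub>m n n $$ (i, j)"
      using coeffs[OF ij, of 0] M C[of 0] by (auto simp del: index_mult_mat(1) split: if_splits)
  qed (use M C[of 0] in auto)
  finally show ?thesis .
qed

section \<open>Algebraic positivity from positive eigenvectors\<close>

text \<open>For \<open>g = char_poly M / (X - l)\<close>, Cayley--Hamilton makes the columns of \<open>g(M)\<close> multiples of \<open>w\<close> and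
  its rows multiples of \<open>z\<close>; it is nonzero because \<open>g(M) w = g(l) w\<close>.\<close>

lemma simple_positive_eigenvectors_imp_alg_positive:
  assumes M: "M \<in> carrier_mat n n" and order: "order l (char_poly M) = 1"
    and w: "w \<in> carrier_vec n" and evw: "M *\<^sub>v w = l \<cdot>\<^sub>v w"
    and z: "z \<in> carrier_vec n" and evz: "transpose_mat M *\<^sub>v z = l \<cdot>\<^sub>v z"
    and wpos: "\<And>i. i < n \<Longrightarrow> w $ i > 0" and zpos: "\<And>i. i < n \<Longrightarrow> z $ i > 0"
  shows "alg_positive M"
proof (cases "n = 0")
  case True
  thus ?thesis using M by (auto simp: alg_positive_def)
next
  case False
  hence n: "0 < n" by simp
  have "char_poly M \<noteq> 0" using degree_monic_char_poly[OF M] by auto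
  from order_decomp[OF this, of l] order obtain g
    where fac: "char_poly M = [:- l, 1:] * g" and ndvd: "\<not> [:- l, 1:] dvd g" by auto
  have gl: "poly g l \<noteq> 0" using ndvd by (simp add: poly_eq_0_iff_dvd)
  \<comment> \<open>The product with X - l in the form to which the evaluation rules for sums,
    \<open>smult\<close> and \<open>pCons\<close> apply.\<close>
  have fac': "char_poly M = Polynomial.smult (- l) g + pCons 0 g" unfolding fac by simp
  define G where "G = mat_poly g M"
  have G: "G \<in> carrier_mat n n" using mat_poly_closed[OF M] by (simp add: G_def)
  have MG: "(\<Sum>k<n. M $$ (i, k) * G $$ (k, j)) = l * G $$ (i, j)" if "i < n" "j < n" for i j
  proof -
    have "0 = mat_poly (char_poly M) M $$ (i, j)" using that by (simp add: cayley_hamilton[OF M])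
    thus ?thesis using that unfolding fac'
      by (simp del: Polynomial.smult_minus_left add_uminus_conv_diff uminus_add_conv_diff add: mat_poly_add_entry[OF M] mat_poly_smult_entry[OF M] mat_poly_pCons_entry[OF M] G_def)
  qed
  have GM: "(\<Sum>k<n. M $$ (k, j) * G $$ (i, k)) = l * G $$ (i, j)" if "i < n" "j < n" for i j
    using arg_cong[OF mat_poly_commute[OF M, of g, folded G_def], of "\<lambda>A. A $$ (i, j)"] MG[OF that] M G that
    by (simp add: scalar_prod_def lessThan_atLeast0 mult.commute)
  have col: "G $$ (i, j) = (G $$ (0, j) / w $ 0) * w $ i" if ij: "i < n" "j < n" for i j
  proof -
    have "vec n (\<lambda>i. G $$ (i, j)) = (vec n (\<lambda>i. G $$ (i, j)) $ 0 / w $ 0) \<cdot>\<^sub>v w"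
      by (rule simple_root_eigenspace[OF M order w evw n])
        (use MG ij wpos[OF n] in \<open>auto simp: eigen_eq_iff[OF M]\<close>)
    from arg_cong[OF this, of "\<lambda>x. x $ i"] show ?thesis using ij n w by simp
  qed
  \<comment> \<open>The same eigenspace argument for the transpose, which has the same
    characteristic polynomial.\<close>
  have row: "G $$ (i, j) = (G $$ (i, 0) / z $ 0) * z $ j" if ij: "i < n" "j < n" for i j
  proof -
    have "vec n (\<lambda>j. G $$ (i, j)) = (vec n (\<lambda>j. G $$ (i, j)) $ 0 / z $ 0) \<cdot>\<^sub>v z"
      by (rule simple_root_eigenspace[OF _ _ z evz n])
        (use M order GM ij zpos[OF n] in \<open>auto simp: transpose_eigen_eq_iff[OF M]\<close>)
    from arg_cong[OF this, of "\<lambda>x. x $ j"] show ?thesis using ij n z by simp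
  qed
  \<comment> \<open>Column proportionality reduces entry (i, j) to (0, j), row proportionality
    reduces that to (0, 0).\<close>
  define c where "c = G $$ (0, 0) / (w $ 0 * z $ 0)"
  have Gc: "G $$ (i, j) = c * (w $ i * z $ j)" if "i < n" "j < n" for i j
    using col[OF that] row[OF n that(2)] by (simp add: c_def field_simps)
  have "c \<noteq> 0"
  proof
    assume "c = 0"
    hence "(\<Sum>j<n. G $$ (0, j) * w $ j) = 0" using n by (simp add: Gc)
    thus False using mat_poly_eigenvector[OF M w evw n, of g] gl wpos[OF n] by (simp add: G_def)
  qed
  \<comment> \<open>Dividing by \<open>c\<close> removes its unknown sign and leaves the positive
    entries w_i z_j.\<close>
  hence "mat_poly (Polynomial.smult (1 / c) g) M $$ (i, j) > 0" if "i < n" "j < n" for i j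
    using that wpos zpos by (simp add: mat_poly_smult_entry[OF M] Gc flip: G_def)
  thus ?thesis using M unfolding alg_positive_def by auto
qed

section \<open>Rows and columns of the extended matrix\<close>

lemma sum_lessThan_add:
  "(\<Sum>q<k + n. f q) = (\<Sum>q<k. f q) + (\<Sum>q<n. f (k + q))" for f :: "nat \<Rightarrow> 'a :: comm_monoid_add"
  by (induction n) (simp_all add: add.assoc)

context
  fixes n k j :: nat and A :: "real mat" and l :: real
  assumes A: "A \<in> carrier_mat n n" and k: "k \<ge> 1" and j: "j \<in> {1..n}"
begin

lemma B_mat_closed: "B_mat k A j l \<in> carrier_mat (k + n) (k + n)"
  using A by (simp add: B_mat_def Let_def)

text \<open>Zero-based entries arranged by rows. Sums of single-point terms replace the nested cases
  so that row sums collapse; the subtracted term deletes the entry moved out of row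
  \<open>k\<close>.\<close>

lemma B_mat_entry:
  assumes "p < k + n" and "q < k + n"
  shows "B_mat k A j l $$ (p, q) =
    (if p < k then (if q = p then l - A $$ (0, j - 1) else 0)
        + (if q = (if p + 1 < k then p + 1 else k + j - 1) then A $$ (0, j - 1) else 0)
     else if q < k then (if p = k \<and> q = 0 then A $$ (0, j - 1) else 0)
     else A $$ (p - k, q - k) - (if p = k \<and> q = k + j - 1 then A $$ (0, j - 1) else 0))"
proof -
  have super: "(p + 1, q + 1) \<in> {(k, k + j), (k + 1, 1)} \<union> {(i, i + 1) | i. 1 \<le> i \<and> i \<le> k - 1}
      \<longleftrightarrow> p + 1 = k \<and> q + 1 = k + j \<or> p = k \<and> q = 0 \<or> p + 1 < k \<and> q = p + 1"
    by auto
  have "B_mat k A j l $$ (p, q) = B_entry k n (\<lambda>r s. A $$ (r - 1, s - 1)) j l (p + 1) (q + 1)"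
    using assms A by (simp add: B_mat_def Let_def)
  also have "\<dots> = (if p = q \<and> p < k then l - A $$ (0, j - 1)
      else if p + 1 = k \<and> q + 1 = k + j \<or> p = k \<and> q = 0 \<or> p + 1 < k \<and> q = p + 1 then A $$ (0, j - 1)
      else if k \<le> p \<and> k \<le> q \<and> (p, q + 1) \<noteq> (k, k + j) then A $$ (p - k, q - k)
      else 0)"
    unfolding B_entry_def super using assms by (intro if_cong) auto
  finally have entry: "B_mat k A j l $$ (p, q) = \<dots>" .
  consider "p + 1 < k" | "p + 1 = k" | "p = k" | "k < p" by linarith
  thus ?thesis
  proof cases
    case 1
    thus ?thesis unfolding entry by simp
  next
    case 2
    moreover have "q + 1 = k + j \<longleftrightarrow> q = k + j - 1" using j by auto
    ultimately show ?thesis unfolding entry using j by auto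
  next
    case 3
    moreover have "q + 1 = k + j \<longleftrightarrow> q = k + j - 1" using j by auto
    ultimately show ?thesis unfolding entry using k by simp
  next
    case 4
    thus ?thesis unfolding entry by simp
  qed
qed

text \<open>The same matrix arranged by columns: a left column holds its diagonal entry and one copy
  of the moved entry, in row \<open>k\<close> for column 0 and just above the diagonal
  otherwise.\<close>

lemma B_mat_entry_columns:
  assumes "p < k + n" and "q < k + n"
  shows "B_mat k A j l $$ (p, q) =
    (if q < k then (if p = q then l - A $$ (0, j - 1) else 0)
        + (if p = (if q = 0 then k else q - 1) then A $$ (0, j - 1) else 0)
     else if p < k then (if p = k - 1 \<and> q = k + j - 1 then A $$ (0, j - 1) else 0)
     else A $$ (p - k, q - k) - (if p = k \<and> q = k + j - 1 then A $$ (0, j - 1) else 0))"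
  using assms k j unfolding B_mat_entry[OF assms] by auto

text \<open>Equated with l times \<open>x p\<close>, such a row says that \<open>x\<close> agrees at
  \<open>p\<close> and at its successor, where the successor of k - 1 is k + j - 1.\<close>

lemma B_mat_row_top:
  assumes "p < k"
  shows "(\<Sum>q<k + n. B_mat k A j l $$ (p, q) * x q) =
    (l - A $$ (0, j - 1)) * x p + A $$ (0, j - 1) * x (if p + 1 < k then p + 1 else k + j - 1)"
proof -
  have "(\<Sum>q<k + n. B_mat k A j l $$ (p, q) * x q) =
    (\<Sum>q<k + n. (if q = p then (l - A $$ (0, j - 1)) * x q else 0)
      + (if q = (if p + 1 < k then p + 1 else k + j - 1) then A $$ (0, j - 1) * x q else 0))"
    by (rule sum.cong) (use assms in \<open>auto simp: B_mat_entry distrib_right\<close>)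
  moreover have "(if p + 1 < k then p + 1 else k + j - 1) < k + n" using assms j by auto
  ultimately show ?thesis using assms by (simp add: sum.distrib)
qed

text \<open>Row \<open>k\<close> carries its entry in column 0 instead of column k + j - 1, so it
  acts as the first row of \<open>A\<close> when \<open>x\<close> agrees at these two
  indices.\<close>

lemma B_mat_row_bottom:
  assumes "p < n"
  shows "(\<Sum>q<k + n. B_mat k A j l $$ (k + p, q) * x q) =
    (\<Sum>q<n. A $$ (p, q) * x (k + q)) + (if p = 0 then A $$ (0, j - 1) * (x 0 - x (k + j - 1)) else 0)"
proof -
  have "(\<Sum>q<k. B_mat k A j l $$ (k + p, q) * x q) =
      (\<Sum>q<k. if q = 0 then (if p = 0 then A $$ (0, j - 1) * x 0 else 0) else 0)"
    by (rule sum.cong) (use assms in \<open>auto simp: B_mat_entry\<close>)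
  moreover have "(\<Sum>q<n. B_mat k A j l $$ (k + p, k + q) * x (k + q)) =
      (\<Sum>q<n. A $$ (p, q) * x (k + q)
        - (if q = j - 1 then (if p = 0 then A $$ (0, j - 1) * x (k + (j - 1)) else 0) else 0))"
    by (rule sum.cong) (use assms j in \<open>auto simp: B_mat_entry left_diff_distrib\<close>)
  ultimately show ?thesis using k j
    by (auto simp: sum_lessThan_add sum_subtractf right_diff_distrib)
qed

text \<open>The dual chain for left eigenvectors: index \<open>q\<close> is tied to q - 1, and index
  0 to \<open>k\<close>.\<close>

lemma B_mat_column_left:
  assumes "q < k"
  shows "(\<Sum>p<k + n. B_mat k A j l $$ (p, q) * x p) =
    (l - A $$ (0, j - 1)) * x q + A $$ (0, j - 1) * x (if q = 0 then k else q - 1)"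
proof -
  have "(\<Sum>p<k + n. B_mat k A j l $$ (p, q) * x p) =
    (\<Sum>p<k + n. (if p = q then (l - A $$ (0, j - 1)) * x p else 0)
      + (if p = (if q = 0 then k else q - 1) then A $$ (0, j - 1) * x p else 0))"
    by (rule sum.cong) (use assms in \<open>auto simp: B_mat_entry_columns distrib_right\<close>)
  moreover have "(if q = 0 then k else q - 1) < k + n" using assms j by auto
  ultimately show ?thesis using assms by (simp add: sum.distrib)
qed

text \<open>Column k + j - 1 has its entry in row k - 1 instead of row \<open>k\<close>; the
  correction vanishes when \<open>x\<close> agrees there.\<close>

lemma B_mat_column_right:
  assumes "q < n"
  shows "(\<Sum>p<k + n. B_mat k A j l $$ (p, k + q) * x p) =
    (\<Sum>p<n. A $$ (p, q) * x (k + p)) + (if q = j - 1 then A $$ (0, j - 1) * (x (k - 1) - x k) else 0)"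
proof -
  have "(\<Sum>p<k. B_mat k A j l $$ (p, k + q) * x p) =
      (\<Sum>p<k. if p = k - 1 then (if q = j - 1 then A $$ (0, j - 1) * x p else 0) else 0)"
    by (rule sum.cong) (use assms j in \<open>auto simp: B_mat_entry_columns\<close>)
  moreover have "(\<Sum>p<n. B_mat k A j l $$ (k + p, k + q) * x (k + p)) =
      (\<Sum>p<n. A $$ (p, q) * x (k + p)
        - (if p = 0 then (if q = j - 1 then A $$ (0, j - 1) * x k else 0) else 0))"
    by (rule sum.cong) (use assms j in \<open>auto simp: B_mat_entry_columns left_diff_distrib\<close>)
  ultimately show ?thesis using k j
    by (auto simp: sum_lessThan_add sum_subtractf right_diff_distrib)
qed

end


section \<open>Transfer of the simple eigenvalue and its eigenvectors from \<open>A\<close> to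
  \<open>B\<close>\<close>

theorem theorem2p2:
  fixes n k j :: nat and A :: "real mat" and l :: real and u v :: "real vec"
  assumes "n \<ge> 1" and "k \<ge> 1"
    and "A \<in> carrier_mat n n"
    and "j \<in> {1..n}" and "A $$ (0, j - 1) < 0"
    and "l > 0" and "simple_eigenvalue A l"
    and "u \<in> carrier_vec n" and "v \<in> carrier_vec n"
    and "\<forall>i < n. u $ i > 0" and "\<forall>i < n. v $ i > 0"
    and "A *\<^sub>v u = l \<cdot>\<^sub>v u" and "transpose_mat A *\<^sub>v v = l \<cdot>\<^sub>v v"
  shows "simple_eigenvalue (B_mat k A j l) l
    \<and> B_mat k A j l *\<^sub>v vec (k + n) (\<lambda>i. if i < k then u $ (j - 1) else u $ (i - k))
        = l \<cdot>\<^sub>v vec (k + n) (\<lambda>i. if i < k then u $ (j - 1) else u $ (i - k))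
    \<and> transpose_mat (B_mat k A j l) *\<^sub>v vec (k + n) (\<lambda>i. if i < k then v $ 0 else v $ (i - k))
        = l \<cdot>\<^sub>v vec (k + n) (\<lambda>i. if i < k then v $ 0 else v $ (i - k))
    \<and> alg_positive (B_mat k A j l)"
proof -
  note A = assms(3) and k = assms(2) and j = assms(4)
  note u = assms(8) and v = assms(9)
  define a where "a = A $$ (0, j - 1)"
  have a: "a \<noteq> 0" using assms(5) by (simp add: a_def)
  define B where "B = B_mat k A j l"
  have B: "B \<in> carrier_mat (k + n) (k + n)"
    unfolding B_def by (rule B_mat_closed[OF A k j])
  have row_top: "(\<Sum>q<k + n. B $$ (p, q) * x q) = (l - a) * x p + a * x (if p + 1 < k then p + 1 else k + j - 1)"
    if "p < k" for p x
    unfolding B_def a_def by (rule B_mat_row_top[OF A k j that])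
  have row_bottom: "(\<Sum>q<k + n. B $$ (k + p, q) * x q)
      = (\<Sum>q<n. A $$ (p, q) * x (k + q)) + (if p = 0 then a * (x 0 - x (k + j - 1)) else 0)"
    if "p < n" for p x
    unfolding B_def a_def by (rule B_mat_row_bottom[OF A k j that])
  have col_left: "(\<Sum>p<k + n. B $$ (p, q) * x p) = (l - a) * x q + a * x (if q = 0 then k else q - 1)"
    if "q < k" for q x
    unfolding B_def a_def by (rule B_mat_column_left[OF A k j that])
  have col_right: "(\<Sum>p<k + n. B $$ (p, k + q) * x p)
      = (\<Sum>p<n. A $$ (p, q) * x (k + p)) + (if q = j - 1 then a * (x (k - 1) - x k) else 0)"
    if "q < n" for q x
    unfolding B_def a_def by (rule B_mat_column_right[OF A k j that])
  have split: "(\<forall>i<k + n. Q i) \<longleftrightarrow> (\<forall>i<k. Q i) \<and> (\<forall>i<n. Q (k + i))" for Q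
  proof (intro iffI allI impI)
    fix i assume Q: "(\<forall>i<k. Q i) \<and> (\<forall>i<n. Q (k + i))" and i: "i < k + n"
    show "Q i"
    proof (cases "i < k")
      case False
      hence "Q (k + (i - k))" using Q i by (intro conjunct2[OF Q, rule_format]) simp
      thus ?thesis using False by simp
    qed (use Q in simp)
  qed auto
  define w where "w = vec (k + n) (\<lambda>i. if i < k then u $ (j - 1) else u $ (i - k))"
  define z where "z = vec (k + n) (\<lambda>i. if i < k then v $ 0 else v $ (i - k))"
  have w: "w \<in> carrier_vec (k + n)" and z: "z \<in> carrier_vec (k + n)" by (simp_all add: w_def z_def)
  have w_top: "w $ i = u $ (j - 1)" and z_top: "z $ i = v $ 0" if "i < k" for i
    using that by (simp_all add: w_def z_def)
  have w_bottom: "w $ (k + i) = u $ i" and z_bottom: "z $ (k + i) = v $ i" if "i < n" for i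
    using that by (simp_all add: w_def z_def)
  have jn: "j - 1 < n" using j by auto
  have w_j: "w $ (k + j - 1) = u $ (j - 1)" using w_bottom[OF jn] j by simp
  have z_k: "z $ k = v $ 0" using z_bottom[of 0] assms(1) by simp
  have wpos: "w $ i > 0" and zpos: "z $ i > 0" if "i < k + n" for i
  proof -
    have "u $ (j - 1) > 0" "v $ 0 > 0" using jn assms(1,10,11) by simp_all
    moreover have "u $ (i - k) > 0" "v $ (i - k) > 0" if "\<not> i < k"
      using that \<open>i < k + n\<close> assms(10,11) by (simp_all add: less_diff_conv2)
    ultimately show "w $ i > 0" "z $ i > 0" using that by (simp_all add: w_def z_def)
  qed
  \<comment> \<open>\<open>w\<close> is constant on the first \<open>k\<close> indices with the
    value it has at k + j - 1, so every correction term vanishes.\<close>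
  have evw: "B *\<^sub>v w = l \<cdot>\<^sub>v w"
    unfolding eigen_eq_iff[OF B w] split
  proof (intro conjI allI impI)
    fix i assume i: "i < k"
    have "w $ (if i + 1 < k then i + 1 else k + j - 1) = u $ (j - 1)" by (simp del: One_nat_def add: w_top w_j)
    thus "(\<Sum>q<k + n. B $$ (i, q) * w $ q) = l * w $ i"
      unfolding row_top[OF i] w_top[OF i] by (simp add: left_diff_distrib)
  next
    fix i assume i: "i < n"
    thus "(\<Sum>q<k + n. B $$ (k + i, q) * w $ q) = l * w $ (k + i)"
      using assms(12) k unfolding eigen_eq_iff[OF A u] by (simp del: One_nat_def add: row_bottom w_bottom w_top w_j)
  qed
  \<comment> \<open>Dually, \<open>z\<close> is constant on the indices 0 to
    \<open>k\<close>.\<close>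
  have evz: "transpose_mat B *\<^sub>v z = l \<cdot>\<^sub>v z"
    unfolding transpose_eigen_eq_iff[OF B z] split
  proof (intro conjI allI impI)
    fix i assume i: "i < k"
    have "z $ (if i = 0 then k else i - 1) = v $ 0" using i by (simp add: z_top z_k)
    thus "(\<Sum>q<k + n. B $$ (q, i) * z $ q) = l * z $ i"
      unfolding col_left[OF i] z_top[OF i] by (simp add: left_diff_distrib)
  next
    fix i assume i: "i < n"
    thus "(\<Sum>q<k + n. B $$ (q, k + i) * z $ q) = l * z $ (k + i)"
      using assms(13) k unfolding transpose_eigen_eq_iff[OF A v]
      by (simp add: col_right z_bottom z_top z_k)
  qed
  have one: "\<exists>c. y = c \<cdot>\<^sub>v w" if y: "y \<in> carrier_vec (k + n)" and evy: "B *\<^sub>v y = l \<cdot>\<^sub>v y" for y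
  proof -
    have top: "(l - a) * y $ i + a * y $ (if i + 1 < k then i + 1 else k + j - 1) = l * y $ i" if "i < k" for i
      using evy that row_top[OF that, of "\<lambda>q. y $ q"] unfolding eigen_eq_iff[OF B y] by simp
    have next_eq: "y $ (if i + 1 < k then i + 1 else k + j - 1) = y $ i" if "i < k" for i
      using top[OF that] a by (simp only: left_diff_distrib) simp
    \<comment> \<open>Downward induction from k - 1, whose successor in the chain is k + j -
      1.\<close>
    have const: "y $ i = y $ (k + j - 1)" if "i < k" for i
    proof -
      have "i \<le> k - 1" using that by simp
      thus ?thesis
      proof (induction rule: inc_induct)
        case base
        show ?case using next_eq[of "k - 1"] k by simp
      next
        case (step m)
        hence "m < k" "m + 1 < k" by simp_all
        thus ?case using next_eq[of m] step by simp
      qed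
    qed
    \<comment> \<open>By \<open>const\<close> the correction in row \<open>k\<close> is zero, so the
      lower block of \<open>y\<close> satisfies the eigenvector equation of
      \<open>A\<close>.\<close>
    define y' where "y' = vec n (\<lambda>i. y $ (k + i))"
    have y': "y' \<in> carrier_vec n" by (simp add: y'_def)
    have "A *\<^sub>v y' = l \<cdot>\<^sub>v y'"
      unfolding eigen_eq_iff[OF A y']
    proof (intro allI impI)
      fix i assume i: "i < n"
      have "l * y $ (k + i) = (\<Sum>q<n. A $$ (i, q) * y $ (k + q))"
        using evy i row_bottom[OF i, of "\<lambda>q. y $ q"] const[of 0] k unfolding eigen_eq_iff[OF B y] by simp
      thus "(\<Sum>q<n. A $$ (i, q) * y' $ q) = l * y' $ i" using i by (simp add: y'_def)
    qed
    moreover have "order l (char_poly A) = 1" "u $ 0 \<noteq> 0"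
      using assms(1,7,10) by (auto simp: simple_eigenvalue_def)
    ultimately obtain c where c: "y' = c \<cdot>\<^sub>v u"
      using simple_root_eigenspace[OF A _ u assms(12) _ _ y', of 0] assms(1) by auto
    have bottom: "y $ (k + i) = c * w $ (k + i)" if "i < n" for i
      using arg_cong[OF c, of "\<lambda>x. x $ i"] that u by (simp add: y'_def w_bottom)
    have "y $ i = c * w $ i" if "i < k" for i
      using bottom[OF jn] const[OF that] that j by (simp del: One_nat_def add: w_top w_j)
    hence "\<forall>i<k + n. y $ i = c * w $ i" unfolding split using bottom by blast
    hence "y = c \<cdot>\<^sub>v w" using y w by (auto simp: vec_eq_iff)
    thus ?thesis ..
  qed
  \<comment> \<open>Positivity of both eigenvectors provides the nonzero pairing required by
    \<open>eigenspace_simple_root\<close>.\<close>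
  have "(\<Sum>r<k + n. z $ r * w $ r) > 0"
    using assms(1) wpos zpos by (intro sum_pos) auto
  hence order: "order l (char_poly B) = 1"
    by (intro eigenspace_simple_root[OF B w evw z evz _ _ _ one, of 0]) (use wpos[of 0] assms(1) in auto)
  have "eigenvector B w l"
    using evw w B wpos[of 0] assms(1) by (auto simp: eigenvector_def)
  hence "simple_eigenvalue B l" using order by (auto simp: simple_eigenvalue_def eigenvalue_def)
  moreover have "alg_positive B"
    by (rule simple_positive_eigenvectors_imp_alg_positive[OF B order w evw z evz wpos zpos])
  ultimately show ?thesis using evw evz by (simp add: B_def w_def z_def)
qed

end
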